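(* Let $\lambda$ be a nonzero real number and $a,b\in\mathbb{R}$. For all integers $n\ge0$, \[ T_{n,\lambda}^{(a,b)}(x)=T_{n,\lambda}^{(a,b-1)}(x)-\frac{n}{2}\,T_{n-1,\lambda}^{(a-1,b)}(x), \] where for $n=0$ the term $\frac{n}{2}T_{n-1,\lambda}^{(a-1,b)}(x)$ is interpreted as $0$.
   Context: For a nonzero real $\lambda$ and any $x$, set $(x)_{0,\lambda}=1$ and $(x)_{n,\lambda}=x(x-\lambda)\cdots(x-(n-1)\lambda)$ for $n\ge1$. The degenerate exponential is $e_{\lambda}^{x}(t)=\sum_{k\ge0}(x)_{k,\lambda}\frac{t^k}{k!}$ ($=(1+\lambda t)^{x/\lambda}$), $e_\lambda(t)=e_\lambda^1(t)$; generating functions are formal power series in $t$. For $a,b\in\mathbb{R}$ the degenerate Sheffer-type polynomials are defined by $\left(\frac{t}{e_\lambda(t)-1}\right)^{a}\left(\frac{2}{e_\lambda(t)+1}\right)^{b}e_\lambda^x(t)=\sum_{n\ge0}T_{n,\lambda}^{(a,b)}(x)\frac{t^n}{n!}$. *)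

theory Defs
  imports "HOL-Computational_Algebra.Computational_Algebra"
begin

definition degen_ffact :: "real \<Rightarrow> real \<Rightarrow> nat \<Rightarrow> real" where
  "degen_ffact l x n = (\<Prod>i<n. x - of_nat i * l)"

definition degen_exp :: "real \<Rightarrow> real \<Rightarrow> real fps" where
  "degen_exp l x = Abs_fps (\<lambda>k. degen_ffact l x k / fact k)"

(* The real power f^a = (1 + (f - 1))^a by the binomial series. The composition is the
   intended formal substitution only when f has constant term 1; both bases to which it is
   applied below do, see degen_bases_nth_0. *)
definition fps_rpow :: "real fps \<Rightarrow> real \<Rightarrow> real fps" where
  "fps_rpow f a = fps_binomial a oo (f - 1)"

(* Division of formal power series over a field: the division by degen_exp l 1 - 1, which has
   subdegree 1, is exact (see degen_base1_mult). *)
definition degen_sheffer_gf :: "real \<Rightarrow> real \<Rightarrow> real \<Rightarrow> real \<Rightarrow> real fps" where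
  "degen_sheffer_gf l a b x =
     fps_rpow (fps_X / (degen_exp l 1 - 1)) a * fps_rpow (2 / (degen_exp l 1 + 1)) b * degen_exp l x"

definition degen_sheffer :: "real \<Rightarrow> real \<Rightarrow> real \<Rightarrow> nat \<Rightarrow> real \<Rightarrow> real" where
  "degen_sheffer l a b n x = fact n * fps_nth (degen_sheffer_gf l a b x) n"

lemma degen_sheffer_egf:
  "degen_sheffer_gf l a b x = Abs_fps (\<lambda>n. degen_sheffer l a b n x / fact n)"
  by (simp add: fps_eq_iff degen_sheffer_def)

lemma fps_rpow_of_nat:
  assumes "fps_nth f 0 = 1"
  shows "fps_rpow f (of_nat n) = f ^ n"
  using assms unfolding fps_rpow_def fps_binomial_of_nat
  by (simp add: fps_compose_power [symmetric] fps_compose_add_distrib)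

lemma fps_rpow_add:
  assumes "fps_nth f 0 = 1"
  shows "fps_rpow f (a + b) = fps_rpow f a * fps_rpow f b"
  using assms unfolding fps_rpow_def fps_binomial_add_mult
  by (simp add: fps_compose_mult_distrib)

lemma degen_exp_nth_0: "fps_nth (degen_exp l x) 0 = 1"
  by (simp add: degen_exp_def degen_ffact_def)

lemma degen_exp_minus_1: "fps_nth (degen_exp l 1 - 1) 0 = 0" "fps_nth (degen_exp l 1 - 1) (Suc 0) = 1"
  by (simp_all add: degen_exp_def degen_ffact_def)

lemma degen_exp_subdegree: "subdegree (degen_exp l 1 - 1) = 1"
proof (rule subdegreeI)
  show "fps_nth (degen_exp l 1 - 1) 1 \<noteq> 0"
    using degen_exp_minus_1(2)[of l] by simp
  show "fps_nth (degen_exp l 1 - 1) i = 0" if "i < 1" for i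
    using that degen_exp_minus_1(1)[of l] by simp
qed

lemma degen_base1_mult: "fps_X / (degen_exp l 1 - 1) * (degen_exp l 1 - 1) = fps_X"
proof -
  have "degen_exp l 1 - 1 \<noteq> 0"
    using degen_exp_subdegree[of l] by auto
  hence "(degen_exp l 1 - 1) dvd fps_X"
    using fps_dvd_iff[of "degen_exp l 1 - 1" fps_X] degen_exp_subdegree[of l] by simp
  thus ?thesis by simp
qed

lemma degen_bases_nth_0:
  "fps_nth (fps_X / (degen_exp l 1 - 1)) 0 = 1"
  "fps_nth (2 / (degen_exp l 1 + 1)) 0 = 1"
proof -
  have "fps_nth (fps_X / (degen_exp l 1 - 1) * (degen_exp l 1 - 1)) 1 = 1"
    by (simp only: degen_base1_mult) simp
  thus "fps_nth (fps_X / (degen_exp l 1 - 1)) 0 = 1"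
    using degen_exp_minus_1[of l] by (simp add: fps_mult_nth)
  show "fps_nth (2 / (degen_exp l 1 + 1)) 0 = 1"
    by (simp add: fps_divide_unit degen_exp_nth_0 numeral_fps_const)
qed

end

theory Submission
  imports Defs
begin

text \<open>
  With \<open>A = t / (e - 1)\<close> and \<open>B = 2 / (e + 1)\<close>, where \<open>e\<close> is the degenerate exponential, the
  difference of \<open>2 A = A B (e + 1)\<close> and \<open>t B = A B (e - 1)\<close> is \<open>2 A B\<close>. Multiplying this by
  \<open>A\<^sup>a\<^sup>-\<^sup>1 B\<^sup>b\<^sup>-\<^sup>1\<close> gives a relation between generating functions, and the
  recurrence is read off its coefficients.
\<close>

text \<open>Additivity in the exponent, with 1 as one summand.\<close>

lemma fps_rpow_minus_1_mult:
  assumes "fps_nth f 0 = 1"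
  shows "fps_rpow f (a - 1) * f = fps_rpow f a"
  using fps_rpow_add[OF assms, of "a - 1" 1] fps_rpow_of_nat[OF assms, of 1] by simp

text \<open>The division is exact because the divisor has constant term 2 and so is a unit.\<close>

lemma degen_base2_mult: "2 / (degen_exp l 1 + 1) * (degen_exp l 1 + 1) = 2"
proof -
  have "is_unit (degen_exp l 1 + 1)"
    by (simp add: degen_exp_nth_0)
  thus ?thesis by (simp add: unit_imp_dvd)
qed

lemma degen_sheffer_gf_rec:
  "2 * degen_sheffer_gf l a b x =
     2 * degen_sheffer_gf l a (b - 1) x - fps_X * degen_sheffer_gf l (a - 1) b x"
proof -
  define e where "e = degen_exp l 1"
  define A where "A = fps_X / (e - 1)"
  define B where "B = 2 / (e + 1)"
  define P where "P = fps_rpow A (a - 1)"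
  define Q where "Q = fps_rpow B (b - 1)"
  have A: "A * (e - 1) = fps_X" and B: "B * (e + 1) = 2"
    unfolding A_def B_def e_def by (rule degen_base1_mult degen_base2_mult)+
  have "2 * (A * B) = B * (e + 1) * A - A * (e - 1) * B"
    by (simp add: algebra_simps)
  hence AB: "2 * (A * B) = 2 * A - fps_X * B"
    by (simp only: A B)
  have PA: "fps_rpow A a = P * A" and QB: "fps_rpow B b = Q * B"
    unfolding P_def Q_def A_def B_def e_def
    by (simp_all only: fps_rpow_minus_1_mult degen_bases_nth_0)
  have "2 * (P * A * (Q * B) * degen_exp l x) = P * Q * degen_exp l x * (2 * (A * B))"
    by (simp only: ac_simps)
  \<comment> \<open>The first term lacks \<open>B\<close>, which leaves exponent
    \<open>b - 1\<close>; the second lacks \<open>A\<close>, which leaves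
    \<open>a - 1\<close>.\<close>
  also have "\<dots> = 2 * (P * A * Q * degen_exp l x) - fps_X * (P * (Q * B) * degen_exp l x)"
    unfolding AB by (simp only: right_diff_distrib ac_simps)
  finally show ?thesis
    unfolding degen_sheffer_gf_def
    by (simp only: PA QB flip: e_def A_def B_def P_def Q_def)
qed

theorem theorem3p9:
  fixes l a b x :: real and n :: nat
  assumes "l \<noteq> 0"
  shows "degen_sheffer l a b n x =
    degen_sheffer l a (b - 1) n x -
    (if n = 0 then 0 else of_nat n / 2 * degen_sheffer l (a - 1) b (n - 1) x)"
proof -
  have "2 * fps_nth (degen_sheffer_gf l a b x) n =
      2 * fps_nth (degen_sheffer_gf l a (b - 1) x) n -
      fps_nth (fps_X * degen_sheffer_gf l (a - 1) b x) n"
    using arg_cong[OF degen_sheffer_gf_rec, of "\<lambda>f. fps_nth f n" l a b x]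
    by (simp add: numeral_fps_const)
  hence "fps_nth (degen_sheffer_gf l a b x) n = fps_nth (degen_sheffer_gf l a (b - 1) x) n -
      (if n = 0 then 0 else fps_nth (degen_sheffer_gf l (a - 1) b x) (n - 1) / 2)"
    by (simp split: if_splits)
  \<comment> \<open>For positive \<open>n\<close>, \<open>fact n = n * fact (n - 1)\<close> supplies
    the factor \<open>n\<close> of the shifted term.\<close>
  thus ?thesis
    by (cases n) (simp_all add: degen_sheffer_def right_diff_distrib)
qed

end
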